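(* Let $\theta\in\{i,j,k\}$ and let $a,b\in\mathbb{Z}[\theta]$ with $\eta^+(b)\neq 0$. Then there exist $\gamma,\rho\in\mathbb{Z}[\theta]$ such that $a=\gamma b+\rho$ with $\eta^+(\rho)<\eta^+(b)$.
   Context: For $\theta\in\{i,j,k\}$, $\mathbb{Z}[\theta]$ denotes the commutative ring of formal expressions $x+\theta y$ with $x,y\in\mathbb{Z}$, with componentwise addition and multiplication determined by distributivity and $i^2=-1$ (Gaussian integers), $j^2=1$ (hyperbolic integers), $k^2=0$ (parabolic integers); that is, $\mathbb{Z}[\theta]\cong\mathbb{Z}[X]/(X^2-\theta^2)$. For $z=x+\theta y$ define $\eta^+(z)=|x^2-\theta^2y^2|\in\mathbb{Z}_{\ge 0}$. *)

theory Defs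
  imports "HOL-Algebra.Ring"
begin

text \<open>The three choices \<open>i\<close>, \<open>j\<close>, \<open>k\<close> of the adjoined element \<open>\<theta>\<close>, with
  \<open>i\<^sup>2 = -1\<close>, \<open>j\<^sup>2 = 1\<close>, \<open>k\<^sup>2 = 0\<close>.\<close>

datatype theta = Theta_i | Theta_j | Theta_k

fun theta_sq :: "theta \<Rightarrow> int" where
  "theta_sq Theta_i = -1"
| "theta_sq Theta_j = 1"
| "theta_sq Theta_k = 0"

text \<open>The pair \<open>(x, y)\<close> stands for the formal expression \<open>x + \<theta> y\<close>. Expanding
  \<open>(x + \<theta> y) (u + \<theta> v)\<close> by distributivity gives \<open>(x u + \<theta>\<^sup>2 y v) + \<theta> (x v + y u)\<close>.\<close>

definition Z_adj :: "theta \<Rightarrow> (int \<times> int) ring" where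
  "Z_adj \<theta> =
    \<lparr>carrier = UNIV,
     monoid.mult = (\<lambda>(x, y) (u, v). (x * u + theta_sq \<theta> * y * v, x * v + y * u)),
     one = (1, 0),
     zero = (0, 0),
     add = (\<lambda>(x, y) (u, v). (x + u, y + v))\<rparr>"

definition eta_plus :: "theta \<Rightarrow> int \<times> int \<Rightarrow> int" where
  "eta_plus \<theta> = (\<lambda>(x, y). \<bar>x\<^sup>2 - theta_sq \<theta> * y\<^sup>2\<bar>)"

lemma cring_Z_adj: "cring (Z_adj \<theta>)"
proof (intro cringI abelian_groupI comm_monoidI)
  fix x assume "x \<in> carrier (Z_adj \<theta>)"
  show "\<exists>y\<in>carrier (Z_adj \<theta>). y \<oplus>\<^bsub>Z_adj \<theta>\<^esub> x = \<zero>\<^bsub>Z_adj \<theta>\<^esub>"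
    by (rule bexI[of _ "(- fst x, - snd x)"]) (auto simp: Z_adj_def split: prod.splits)
qed (auto simp: Z_adj_def algebra_simps split: prod.splits)

lemma theta_times_theta: "(0, 1) \<otimes>\<^bsub>Z_adj \<theta>\<^esub> (0, 1) = (theta_sq \<theta>, 0)"
  by (simp add: Z_adj_def)

lemma Z_adj_expansion: "(x, y) = (x, 0) \<oplus>\<^bsub>Z_adj \<theta>\<^esub> ((0, 1) \<otimes>\<^bsub>Z_adj \<theta>\<^esub> (y, 0))"
  by (simp add: Z_adj_def)

end

(* The norm N(x + \<theta> y) = x^2 - \<theta>^2 y^2 is multiplicative. Write a b' = p + \<theta> q with b' the conjugate
   of b, round p / N(b) and q / N(b) to nearest integers g and h, and put \<rho> = a - (g + \<theta> h) b.
   Then \<rho> b' = e + \<theta> f with |e|, |f| \<le> |N(b)| / 2, so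
   |N(\<rho>)| |N(b)| = |e^2 - \<theta>^2 f^2| \<le> e^2 + f^2 \<le> N(b)^2 / 2. *)
theory Submission imports Defs begin

text \<open>Here \<open>k\<close> is the floor of p/m + 1/2, a nearest integer to p/m: the remainder
  \<open>c\<close> lies in [0, 2m), so 2(p - km) = c - m lies in [-m, m). Working with m = |n| keeps
  the divisor positive; the factor \<open>sgn n\<close> then moves the sign of n into the
  quotient.\<close>

lemma nearest_multiple:
  fixes p n :: int
  assumes "n \<noteq> 0"
  obtains g where "2 * \<bar>p - g * n\<bar> \<le> \<bar>n\<bar>"
proof -
  define m where "m = \<bar>n\<bar>"
  have m: "m > 0" using assms by (simp add: m_def)
  define k where "k = (2 * p + m) div (2 * m)"
  define c where "c = (2 * p + m) mod (2 * m)"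
  have "2 * (p - k * m) = c - m"
    using mult_div_mod_eq[of "2 * m" "2 * p + m"] unfolding k_def c_def by (simp add: algebra_simps)
  moreover have "0 \<le> c" "c < 2 * m"
    using m by (simp_all add: c_def)
  ultimately have "2 * \<bar>p - k * m\<bar> \<le> m" by linarith
  moreover have "k * m = (k * sgn n) * n"
    by (simp add: m_def abs_sgn mult_ac)
  ultimately have "2 * \<bar>p - (k * sgn n) * n\<bar> \<le> \<bar>n\<bar>"
    by (simp only: m_def)
  then show thesis by (rule that)
qed

theorem theorem1:
  fixes \<theta> :: theta and a b :: "int \<times> int"
  assumes "a \<in> carrier (Z_adj \<theta>)" and "b \<in> carrier (Z_adj \<theta>)"
    and "eta_plus \<theta> b \<noteq> 0"
  shows "\<exists>\<gamma>\<in>carrier (Z_adj \<theta>). \<exists>\<rho>\<in>carrier (Z_adj \<theta>).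
    a = (\<gamma> \<otimes>\<^bsub>Z_adj \<theta>\<^esub> b) \<oplus>\<^bsub>Z_adj \<theta>\<^esub> \<rho> \<and> eta_plus \<theta> \<rho> < eta_plus \<theta> b"
proof -
  obtain x y u v where ab: "a = (x, y)" "b = (u, v)" by fastforce
  define s where "s = theta_sq \<theta>"
  \<comment> \<open>The estimates below use only this bound on \<theta>^2, so the three rings are
    treated uniformly.\<close>
  have s: "\<bar>s\<bar> \<le> 1" by (cases \<theta>) (simp_all add: s_def)
  define n where "n = u\<^sup>2 - s * v\<^sup>2"
  have n: "n \<noteq> 0" using assms(3) by (simp add: ab eta_plus_def n_def s_def)
  \<comment> \<open>The two numbers rounded here and next are the components of a b', where b' = (u,
    -v).\<close>
  obtain g where g: "2 * \<bar>(x * u - s * y * v) - g * n\<bar> \<le> \<bar>n\<bar>"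
    using nearest_multiple[OF n] .
  obtain h where h: "2 * \<bar>(y * u - x * v) - h * n\<bar> \<le> \<bar>n\<bar>"
    using nearest_multiple[OF n] .
  define e where "e = (x * u - s * y * v) - g * n"
  define f where "f = (y * u - x * v) - h * n"
  define r where "r = x - (g * u + s * h * v)"
  define t where "t = y - (g * v + h * u)"
  \<comment> \<open>Because b b' = n, subtracting (g + \<theta> h) n from a b' leaves \<rho> b' with
    \<rho> = \<open>(r, t)\<close>.\<close>
  have e: "e = r * u - s * t * v" and f: "f = t * u - r * v"
    by (simp_all add: e_def f_def r_def t_def n_def power2_eq_square algebra_simps)
  \<comment> \<open>Multiplicativity of the norm for \<rho> and b'; the norm of b' is again
    n.\<close>
  have norm_mult: "(r\<^sup>2 - s * t\<^sup>2) * n = e\<^sup>2 - s * f\<^sup>2"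
    by (simp add: e f n_def power2_eq_square algebra_simps)
  have "(2 * e)\<^sup>2 \<le> n\<^sup>2" "(2 * f)\<^sup>2 \<le> n\<^sup>2"
    using g h by (simp_all only: abs_le_square_iff[symmetric] e_def f_def abs_mult abs_numeral)
  then have ef: "2 * (e\<^sup>2 + f\<^sup>2) \<le> n\<^sup>2" by (simp add: power_mult_distrib)
  have "\<bar>r\<^sup>2 - s * t\<^sup>2\<bar> * \<bar>n\<bar> = \<bar>e\<^sup>2 - s * f\<^sup>2\<bar>"
    by (metis norm_mult abs_mult)
  also have "\<dots> \<le> e\<^sup>2 + \<bar>s\<bar> * f\<^sup>2"
    using abs_triangle_ineq4[of "e\<^sup>2" "s * f\<^sup>2"] by (simp add: abs_mult)
  also have "\<dots> \<le> e\<^sup>2 + f\<^sup>2"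
    using mult_right_mono[OF s, of "f\<^sup>2"] by simp
  \<comment> \<open>Strictness comes from n^2 / 2 < n^2, as n is nonzero.\<close>
  also have "\<dots> < n\<^sup>2"
    using ef zero_less_power2[THEN iffD2, OF n] by (smt (verit))
  also have "n\<^sup>2 = \<bar>n\<bar> * \<bar>n\<bar>" by (simp add: power2_eq_square)
  finally have "\<bar>r\<^sup>2 - s * t\<^sup>2\<bar> < \<bar>n\<bar>"
    by (rule mult_right_less_imp_less) simp
  then have "eta_plus \<theta> (r, t) < eta_plus \<theta> b"
    by (simp add: eta_plus_def ab n_def s_def)
  moreover have "a = ((g, h) \<otimes>\<^bsub>Z_adj \<theta>\<^esub> b) \<oplus>\<^bsub>Z_adj \<theta>\<^esub> (r, t)"
    by (simp add: Z_adj_def ab r_def t_def s_def)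
  ultimately show ?thesis by (auto simp: Z_adj_def)
qed

end
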